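(* Let $r\ge 4$, $k\ge r-2$, and let $\mathbb{T}=\{L_1,\dots,L_r\}$ be an $r$-set of non-intersecting type such that $\left|\bigcup_{i=1}^r L_i\right|=\frac{r(k+1)}{2}$. Put $a_{i,j}=|L_i\cap L_j|$ for $1\le i<j\le r$. Then the tuple $(a_{i,j})_{1\le i<j\le r}$ corresponds one-to-one to the tuple $(a_{l,t})_{2\le l<t\le r}$ (that is, two such $r$-sets with the same tuple $(a_{l,t})_{2\le l<t\le r}$ have the same tuple $(a_{i,j})_{1\le i<j\le r}$), and the tuple $(a_{l,t})_{2\le l<t\le r}$ in turn corresponds to the decomposition into the sum of positive integers $$\frac{(r-2)(k+1)}{2}=\sum_{2\le l<t\le r}a_{l,t}.$$
   Context: Write $[m]=\{1,\dots,m\}$. A collection $\mathbb{T}=\{L_1,\dots,L_r\}$ of subsets $L_i\subset[n]$ with $|L_i|=k+1$ for all $i$ is called an $r$-set if $\bigcup_{i=1}^r L_i=\bigcup_{i\in I}L_i$ for every $I\subset[r]$ with $|I|=r-1$, and $L_i\cap L_j\ne\emptyset$ for all $1\le i<j\le r$. For $r\ge 4$, an $r$-set is of non-intersecting type if $L_i\cap L_j\cap L_m=\emptyset$ for all pairwise distinct $i,j,m\in[r]$. *)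

theory Defs
  imports Complex_Main "HOL-Library.FuncSet"
begin

text \<open>
  A collection of r sets is an indexed family \<open>L\<close> of which only the members \<open>L 1, ..., L r\<close> matter.
  Repetitions among them are not excluded; in fact for \<open>r = 2\<close> the covering condition forces
  \<open>L 1 = L 2\<close>, while for the families of non-intersecting type distinctness is automatic.
\<close>

definition r_set :: "nat \<Rightarrow> nat \<Rightarrow> nat \<Rightarrow> (nat \<Rightarrow> nat set) \<Rightarrow> bool" where
  "r_set n k r L \<longleftrightarrow>
     (\<forall>i\<in>{1..r}. L i \<subseteq> {1..n} \<and> card (L i) = k + 1) \<and>
     (\<forall>I. I \<subseteq> {1..r} \<and> card I = r - 1 \<longrightarrow> (\<Union>i\<in>{1..r}. L i) = (\<Union>i\<in>I. L i)) \<and>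
     (\<forall>i j. 1 \<le> i \<and> i < j \<and> j \<le> r \<longrightarrow> L i \<inter> L j \<noteq> {})"

definition non_intersecting_type :: "nat \<Rightarrow> (nat \<Rightarrow> nat set) \<Rightarrow> bool" where
  "non_intersecting_type r L \<longleftrightarrow>
     (\<forall>i\<in>{1..r}. \<forall>j\<in>{1..r}. \<forall>m\<in>{1..r}.
        i \<noteq> j \<and> i \<noteq> m \<and> j \<noteq> m \<longrightarrow> L i \<inter> L j \<inter> L m = {})"

definition half_r_sets :: "nat \<Rightarrow> nat \<Rightarrow> nat \<Rightarrow> (nat \<Rightarrow> nat set) set" where
  "half_r_sets n k r =
     {L. r_set n k r L \<and> non_intersecting_type r L \<and>
         real (card (\<Union>i\<in>{1..r}. L i)) = real r * (real k + 1) / 2}"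

definition index_pairs :: "nat \<Rightarrow> nat \<Rightarrow> (nat \<times> nat) set" where
  "index_pairs s r = {(i, j). s \<le> i \<and> i < j \<and> j \<le> r}"

text \<open>
  The tuple of the numbers \<open>card (L i \<inter> L j)\<close> for \<open>s \<le> i < j \<le> r\<close>. It is undefined off its index set,
  so equality of two tuples means equality of all their entries.
\<close>

definition intersection_tuple :: "nat \<Rightarrow> nat \<Rightarrow> (nat \<Rightarrow> nat set) \<Rightarrow> nat \<times> nat \<Rightarrow> nat" where
  "intersection_tuple s r L = (\<lambda>(i, j)\<in>index_pairs s r. card (L i \<inter> L j))"

end

theory Submission
  imports Defs
begin

text \<open>
  Deleting \<open>L i\<close> from the family leaves the union unchanged, so \<open>L i\<close> is covered by its
  intersections with the other members; these are disjoint because no point lies in three members.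
  Hence every row sum \<open>\<Sum>j\<noteq>i. card (L i \<inter> L j)\<close> equals \<open>k + 1\<close>. For \<open>i \<ge> 2\<close> this expresses the entry
  \<open>(1, i)\<close> through entries with indices at least 2, and summing the rows \<open>i \<ge> 2\<close> and subtracting row 1
  gives twice the sum over \<open>2 \<le> l < t \<le> r\<close>.
\<close>

lemma finite_index_pairs: "finite (index_pairs s r)"
  by (rule finite_subset[of _ "{s..r} \<times> {s..r}"]) (auto simp: index_pairs_def)

text \<open>The off-diagonal part of the square is the disjoint union of the triangle
  \<open>i < j\<close> and its mirror image, and a symmetric \<open>f\<close> has the same sum over
  both.\<close>

lemma sum_off_diagonal_symmetric:
  fixes f :: "nat \<Rightarrow> nat \<Rightarrow> 'a::semiring_1"
  assumes "\<And>i j. f i j = f j i"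
  shows "(\<Sum>i\<in>{s..r}. \<Sum>j\<in>{s..r}-{i}. f i j) = 2 * (\<Sum>(i, j)\<in>index_pairs s r. f i j)"
proof -
  let ?P = "index_pairs s r" and ?Q = "prod.swap ` index_pairs s r"
  have "(\<Sum>i\<in>{s..r}. \<Sum>j\<in>{s..r}-{i}. f i j) = (\<Sum>(i, j)\<in>(SIGMA i:{s..r}. {s..r}-{i}). f i j)"
    by (simp add: sum.Sigma)
  also have "(SIGMA i:{s..r}. {s..r}-{i}) = ?P \<union> ?Q"
    by (auto simp: index_pairs_def image_iff)
  also have "(\<Sum>(i, j)\<in>?P \<union> ?Q. f i j) = (\<Sum>(i, j)\<in>?P. f i j) + (\<Sum>(i, j)\<in>?Q. f i j)"
    by (rule sum.union_disjoint) (auto simp: finite_index_pairs, auto simp: index_pairs_def)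
  also have "(\<Sum>(i, j)\<in>?Q. f i j) = (\<Sum>(i, j)\<in>?P. f i j)"
    by (subst sum.reindex) (auto simp: case_prod_unfold intro!: sum.cong assms)
  finally show ?thesis
    by (simp add: mult_2)
qed

lemma r_set_card: "r_set n k r L \<Longrightarrow> i \<in> {1..r} \<Longrightarrow> card (L i) = k + 1"
  unfolding r_set_def by (elim conjE) (drule (1) bspec, erule conjunct2)

lemma r_set_finite: "r_set n k r L \<Longrightarrow> i \<in> {1..r} \<Longrightarrow> finite (L i)"
  by (rule card_ge_0_finite) (simp add: r_set_card)

text \<open>This is the covering condition for the index set \<open>{1..r} - {i}\<close>, which has
  exactly \<open>r - 1\<close> elements.\<close>

lemma r_set_subset_other_members:
  assumes "r_set n k r L" and "i \<in> {1..r}"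
  shows "L i \<subseteq> (\<Union>j\<in>{1..r}-{i}. L j)"
proof -
  have "card ({1..r} - {i}) = r - 1"
    using assms(2) by simp
  moreover have "\<forall>I. I \<subseteq> {1..r} \<and> card I = r - 1 \<longrightarrow> (\<Union>j\<in>{1..r}. L j) = (\<Union>j\<in>I. L j)"
    using assms(1) unfolding r_set_def by (elim conjE)
  ultimately have "(\<Union>j\<in>{1..r}. L j) = (\<Union>j\<in>{1..r}-{i}. L j)"
    by (elim allE[of _ "{1..r} - {i}"] impE) (rule conjI, rule Diff_subset)
  then show ?thesis
    using assms(2) by blast
qed

lemma sum_card_Int_other_members:
  assumes "r_set n k r L" and "non_intersecting_type r L" and "i \<in> {1..r}"
  shows "(\<Sum>j\<in>{1..r}-{i}. card (L i \<inter> L j)) = k + 1"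
proof -
  have fin: "finite (L i)" and card: "card (L i) = k + 1"
    using r_set_finite[OF assms(1,3)] r_set_card[OF assms(1,3)] by auto
  have disj: "\<forall>j\<in>{1..r}-{i}. \<forall>m\<in>{1..r}-{i}. j \<noteq> m \<longrightarrow> (L i \<inter> L j) \<inter> (L i \<inter> L m) = {}"
    using assms(2,3) unfolding non_intersecting_type_def by blast
  have "(\<Union>j\<in>{1..r}-{i}. L i \<inter> L j) = L i"
    using r_set_subset_other_members[OF assms(1,3)] by blast
  moreover have "card (\<Union>j\<in>{1..r}-{i}. L i \<inter> L j) = (\<Sum>j\<in>{1..r}-{i}. card (L i \<inter> L j))"
    by (rule card_UN_disjoint[OF _ _ disj]) (simp_all add: fin)
  ultimately show ?thesis
    by (metis card)
qed

text \<open>Row \<open>i\<close> with its one entry involving index 1 split off; all remaining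
  entries are, up to symmetry, entries of \<open>intersection_tuple 2 r L\<close>.\<close>

lemma card_first_Int_eq:
  assumes "r_set n k r L" and "non_intersecting_type r L" and "i \<in> {2..r}"
  shows "card (L 1 \<inter> L i) + (\<Sum>j\<in>{2..r}-{i}. card (L i \<inter> L j)) = k + 1"
proof -
  have "{1..r} - {i} = insert 1 ({2..r} - {i})"
    using assms(3) by auto
  then have "(\<Sum>j\<in>{1..r}-{i}. card (L i \<inter> L j))
      = card (L i \<inter> L 1) + (\<Sum>j\<in>{2..r}-{i}. card (L i \<inter> L j))"
    by simp
  then show ?thesis
    using sum_card_Int_other_members[OF assms(1,2), of i] assms(3) by (simp add: Int_commute)
qed

lemma intersection_tuple_apply:
  "s \<le> i \<Longrightarrow> i < j \<Longrightarrow> j \<le> r \<Longrightarrow> intersection_tuple s r L (i, j) = card (L i \<inter> L j)"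
  by (simp add: intersection_tuple_def index_pairs_def)

lemma restrict_intersection_tuple:
  "s \<le> t \<Longrightarrow> restrict (intersection_tuple s r L) (index_pairs t r) = intersection_tuple t r L"
  by (auto simp: intersection_tuple_def index_pairs_def restrict_def fun_eq_iff)

text \<open>Only the entries \<open>(1, i)\<close> have to be recovered, and each is
  \<open>k + 1\<close> minus the rest of row \<open>i\<close>. This gives injectivity of the
  restriction map.\<close>

lemma intersection_tuple_1_cong:
  assumes "r_set n k r L" "non_intersecting_type r L"
    and "r_set n k r L'" "non_intersecting_type r L'"
    and eq: "intersection_tuple 2 r L = intersection_tuple 2 r L'"
  shows "intersection_tuple 1 r L = intersection_tuple 1 r L'"
proof -
  have less: "card (L i \<inter> L j) = card (L' i \<inter> L' j)" if "2 \<le> i" "i < j" "j \<le> r" for i j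
    using that fun_cong[OF eq, of "(i, j)"] by (simp add: intersection_tuple_apply)
  \<comment> \<open>A row also runs over \<open>j < i\<close>, where the tuple has no entry, so
    those terms are read off from \<open>(j, i)\<close>.\<close>
  have neq: "card (L i \<inter> L j) = card (L' i \<inter> L' j)"
    if "i \<in> {2..r}" "j \<in> {2..r} - {i}" for i j
    using that less[of i j] less[of j i] by (cases "i < j") (auto simp: Int_commute)
  have first: "card (L 1 \<inter> L i) = card (L' 1 \<inter> L' i)" if i: "i \<in> {2..r}" for i
  proof -
    have "(\<Sum>j\<in>{2..r}-{i}. card (L i \<inter> L j)) = (\<Sum>j\<in>{2..r}-{i}. card (L' i \<inter> L' j))"
      using neq[OF i] by (rule sum.cong[OF refl])
    then show ?thesis
      using card_first_Int_eq[OF assms(1,2) i] card_first_Int_eq[OF assms(3,4) i] by linarith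
  qed
  have "card (L i \<inter> L j) = card (L' i \<inter> L' j)" if "1 \<le> i" "i < j" "j \<le> r" for i j
    using that less[of i j] first[of j] by (cases "i = 1") auto
  then show ?thesis
    by (auto simp: intersection_tuple_def index_pairs_def restrict_def fun_eq_iff)
qed

text \<open>Both double counting and subtraction are avoided by moving terms across, so the identity
  holds in the natural numbers without truncation or division.\<close>

lemma double_sum_intersection_tuple_2:
  assumes "r_set n k r L" "non_intersecting_type r L" and "1 \<le> r"
  shows "2 * (\<Sum>p\<in>index_pairs 2 r. intersection_tuple 2 r L p) + 2 * (k + 1) = r * (k + 1)"
proof -
  have split: "{1..r} - {1} = {2..r}"
    by auto
  have "(\<Sum>i\<in>{2..r}. card (L 1 \<inter> L i) + (\<Sum>j\<in>{2..r}-{i}. card (L i \<inter> L j)))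
      = (\<Sum>i\<in>{2..r}. k + 1)"
    by (rule sum.cong[OF refl]) (rule card_first_Int_eq[OF assms(1,2)])
  \<comment> \<open>The split-off entries of the rows \<open>i \<ge> 2\<close> together form row
    1.\<close>
  moreover have "(\<Sum>i\<in>{2..r}. card (L 1 \<inter> L i)) = k + 1"
    using sum_card_Int_other_members[OF assms(1,2), of 1] assms(3) split by simp
  moreover have "(\<Sum>i\<in>{2..r}. \<Sum>j\<in>{2..r}-{i}. card (L i \<inter> L j))
      = 2 * (\<Sum>(i, j)\<in>index_pairs 2 r. card (L i \<inter> L j))"
    by (rule sum_off_diagonal_symmetric) (simp add: Int_commute)
  moreover have "(\<Sum>(i, j)\<in>index_pairs 2 r. card (L i \<inter> L j))
      = (\<Sum>p\<in>index_pairs 2 r. intersection_tuple 2 r L p)"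
    by (rule sum.cong) (auto simp: intersection_tuple_def)
  ultimately have "(k + 1) + 2 * (\<Sum>p\<in>index_pairs 2 r. intersection_tuple 2 r L p) = (r - 1) * (k + 1)"
    by (simp add: sum.distrib)
  moreover have "r * (k + 1) = (r - 1) * (k + 1) + (k + 1)"
    using assms(3) by (cases r) auto
  ultimately show ?thesis
    by simp
qed

lemma intersection_tuple_pos:
  assumes "r_set n k r L" and "1 \<le> s" and "p \<in> index_pairs s r"
  shows "intersection_tuple s r L p > 0"
proof -
  obtain i j where p: "p = (i, j)" "s \<le> i" "i < j" "j \<le> r"
    using assms(3) by (auto simp: index_pairs_def)
  moreover have "1 \<le> i"
    using p assms(2) by simp
  moreover have "\<forall>i j. 1 \<le> i \<and> i < j \<and> j \<le> r \<longrightarrow> L i \<inter> L j \<noteq> {}"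
    using assms(1) unfolding r_set_def by (elim conjE)
  ultimately have "L i \<inter> L j \<noteq> {}"
    by blast
  \<comment> \<open>Nonemptiness alone is not enough, since \<open>card\<close> of an infinite set
    is 0.\<close>
  moreover have "finite (L i)"
    using p \<open>1 \<le> i\<close> by (intro r_set_finite[OF assms(1)]) auto
  ultimately show ?thesis
    using p by (simp add: intersection_tuple_apply card_gt_0_iff)
qed

theorem proposition4p2:
  fixes n k r :: nat
  assumes "r \<ge> 4" and "k \<ge> r - 2"
  shows "bij_betw (\<lambda>a. restrict a (index_pairs 2 r))
           (intersection_tuple 1 r ` half_r_sets n k r)
           (intersection_tuple 2 r ` half_r_sets n k r) \<and>
         (\<forall>L\<in>half_r_sets n k r. \<forall>L'\<in>half_r_sets n k r.
           intersection_tuple 2 r L = intersection_tuple 2 r L' \<longrightarrow>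
           intersection_tuple 1 r L = intersection_tuple 1 r L') \<and>
         (\<forall>L\<in>half_r_sets n k r.
           (\<forall>p\<in>index_pairs 2 r. intersection_tuple 2 r L p > 0) \<and>
           (real r - 2) * (real k + 1) / 2 =
             (\<Sum>p\<in>index_pairs 2 r. real (intersection_tuple 2 r L p)))"
proof (intro conjI ballI impI)
  show determined: "intersection_tuple 1 r L = intersection_tuple 1 r L'"
    if "L \<in> half_r_sets n k r" "L' \<in> half_r_sets n k r"
      "intersection_tuple 2 r L = intersection_tuple 2 r L'" for L L'
    using that(1,2) unfolding half_r_sets_def mem_Collect_eq
    by (elim conjE) (rule intersection_tuple_1_cong[OF _ _ _ _ that(3)])
  \<comment> \<open>Restricting a tuple from 1 yields the tuple from 2 of the same family. Hence
    injectivity is \<open>determined\<close>, and the image is the target set.\<close>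
  have "inj_on (\<lambda>a. restrict a (index_pairs 2 r)) (intersection_tuple 1 r ` half_r_sets n k r)"
    by (intro inj_onI) (auto simp only: restrict_intersection_tuple one_le_numeral intro: determined)
  then show "bij_betw (\<lambda>a. restrict a (index_pairs 2 r))
      (intersection_tuple 1 r ` half_r_sets n k r) (intersection_tuple 2 r ` half_r_sets n k r)"
    by (simp add: bij_betw_def image_image restrict_intersection_tuple)
next
  fix L p
  assume "L \<in> half_r_sets n k r" "p \<in> index_pairs 2 r"
  then show "intersection_tuple 2 r L p > 0"
    unfolding half_r_sets_def mem_Collect_eq
    by (elim conjE) (rule intersection_tuple_pos, simp_all only: one_le_numeral)
next
  fix L
  assume "L \<in> half_r_sets n k r"
  then have "2 * (\<Sum>p\<in>index_pairs 2 r. intersection_tuple 2 r L p) + 2 * (k + 1) = r * (k + 1)"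
    using assms(1) unfolding half_r_sets_def mem_Collect_eq
    by (elim conjE) (rule double_sum_intersection_tuple_2, assumption+, linarith)
  \<comment> \<open>Passing to the reals makes the division by 2 and the difference
    \<open>r - 2\<close> exact.\<close>
  from arg_cong[OF this, of real]
  have "2 * (\<Sum>p\<in>index_pairs 2 r. real (intersection_tuple 2 r L p)) + 2 * (real k + 1)
      = real r * (real k + 1)"
    by (simp only: of_nat_sum of_nat_mult of_nat_add of_nat_numeral of_nat_1)
  then show "(real r - 2) * (real k + 1) / 2
      = (\<Sum>p\<in>index_pairs 2 r. real (intersection_tuple 2 r L p))"
    by (simp add: left_diff_distrib)
qed

end
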